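(* Let $K$ be a finite simplicial complex with a position function $v:K_0\to\mathbb{R}^d$, let $F:\mathcal{D}\to\mathcal{B}$ be a feature map with a labeled decomposition $\hat F:\hat{\mathcal{D}}_K\to\mathcal{B}^{S(K)}$, and let $g:\mathcal{B}\to\mathbb{R}$ be a function (not necessarily linear). Let $h:\mathbb{R}^m\to\mathbb{R}$ be $g\circ\hat F_\gamma\circ\hat\alpha$ for some $\gamma\in S(K)$, or $g\circ\bar F_\sigma\circ\hat\alpha$ for some $\sigma\in K$, or $g\circ\tilde F_c\circ\hat\alpha$ for some $c\in\mathcal{C}$, with $\hat F,\bar F,\tilde F,\hat\alpha$ as defined in the context. Let $a>0$ and let $$\kappa_a(x)=\frac{1}{a^m(2\pi)^{m/2}}\exp\left(-\frac{1}{2a^2}\|x\|^2\right)$$ be the isotropic Gaussian kernel on $\mathbb{R}^m$. Assume that $\|h\|_\infty\le M$. Then the convolution $h*\kappa_a:\mathbb{R}^m\to\mathbb{R}$ is $\frac{2M}{a\sqrt{2\pi}}$-Lipschitz.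
   Context: Chains. $K$ is a finite abstract simplicial complex: a collection of nonempty subsets of a finite set, closed under taking nonempty subsets and containing all singletons; $K_i$ is the set of simplices of cardinality $i+1$. $S(K)$ is the $\mathbb{Z}/2$-vector space with basis $K$; its elements (chains) are identified with subsets of $K$, and $\|\gamma\|_1$ is the number of simplices in $\gamma$. Persistence. For a total order $\le$ on $K$ extending inclusion $\subseteq$ (a linear extension), the boundary matrix $D$ over $\mathbb{Z}/2$ has rows and columns indexed by $K$ in the order $\le$, with $D_{\sigma\tau}=1$ iff $\sigma\subset\tau$ and $|\sigma|=|\tau|-1$. A matrix $R$ is reduced if distinct nonzero columns have different largest row indices of nonzero entries. A persistence algorithm $\mathcal{A}$ assigns to each boundary matrix $D$ a decomposition $R=DV$ with $R$ reduced and $V$ upper triangular with ones on the diagonal. A birth-death pair is a pair $(\sigma,\tau)$ such that $\sigma$ is the largest row index of a nonzero entry in column $\tau$ of $R$. Each birth-death pair has four associated chains: the birth simplex $\sigma$, the death simplex $\tau$, the representative cycle (sum of all $\rho$ with $R_{\rho\tau}\ne0$) and the bounding chain (sum of all $\rho$ with $V_{\rho\tau}\neq0$). Fix one of these four kinds of chain as the label of birth-death pairs. Diagrams. $\mathcal{D}$ is the set of persistence diagrams, i.e. finite formal sums (multisets) $\sum_i(b_i,d_i)$ with $b_i\le d_i$ real. A labeled persistence diagram is a finite formal sum $\sum_i(b_i,d_i,\ell_i)$ with $b_i\le d_i$; $\hat{\mathcal{D}}_K$ is the set of those arising from $K$, including the empty one $0$, with labels in $S(K)$. $\varphi$ is the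 map forgetting labels. Weights. A weight on $K$ is a function $w:K\to\mathbb{R}$ with $w(\sigma)\le w(\tau)$ whenever $\sigma\subseteq\tau$; $W\subseteq\mathbb{R}^K$ is the set of weights. Fix a persistence algorithm $\mathcal{A}$ and a linear extension $\trianglelefteq$ of $\subseteq$. For $w\in W$, order $K$ by: $\sigma\le_w\tau$ iff $w(\sigma)<w(\tau)$, or $w(\sigma)=w(\tau)$ and $\sigma\trianglelefteq\tau$. Then $\hat\alpha(w)=\sum(w(\sigma),w(\tau),\gamma)$, summed over birth-death pairs $(\sigma,\tau)$ obtained by applying $\mathcal{A}$ to $(K,\le_w)$, where $\gamma$ is the label of the pair. Fix $A\subseteq\mathbb{R}^m$ and $\psi:A\to W$; define $\hat\alpha:\mathbb{R}^m\to\hat{\mathcal{D}}_K$ by $\hat\alpha(a)=\hat\alpha(\psi(a))$ for $a\in A$ and $\hat\alpha(a)=0$ (empty diagram) for $a\notin A$. Feature maps. $\mathcal{B}$ is a separable real Banach space. A feature map is a function $F:\mathcal{D}\to\mathcal{B}$. A labeled decomposition of $F$ is a map $\hat F=(\hat F_\gamma)_{\gamma\in S(K)}:\hat{\mathcal{D}}_K\to\mathcal{B}^{S(K)}$ with $\sum_{\gamma\in S(K)}\hat F_\gamma(\hat a)=F(\varphi(\hat a))$ for all $\hat a\in\hat{\mathcal{D}}_K$. The simplex distribution is $\bar F:\hat{\mathcal{D}}_K\to\mathcal{B}^K$, $\bar F_\sigma(\hat a)=\sum_{\gamma\ni\sigma}\hat F_\gamma(\hat a)/\|\gamma\|_1$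 (sum over chains containing $\sigma$). For the position function $v:K_0\to\mathbb{R}^d$ ($d\ge1$), $|\sigma|$ is the convex hull of $v(\sigma)$, $d_\sigma$ is the dimension of $|\sigma|$, and $|K|=\bigcup_\sigma|\sigma|$. Given a partition of $\mathbb{R}^d$ into translates of a half-open cube $[0,s)^d$ ($s>0$), $\mathcal{C}$ is the finite set of translates that meet $|K|$. The pixel/voxel distribution is $\tilde F:\hat{\mathcal{D}}_K\to\mathcal{B}^{\mathcal{C}}$, $\tilde F_c(\hat a)=\sum_{\sigma\in K}\frac{\operatorname{vol}_{d_\sigma}(|\sigma|\cap c)}{\operatorname{vol}_{d_\sigma}(|\sigma|)}\bar F_\sigma(\hat a)$, where $\operatorname{vol}_k$ is $k$-dimensional volume ($\operatorname{vol}_0$ is counting). Standing convention: $h$ is Borel measurable. $\|h\|_\infty$ is the essential supremum norm; $(h*\kappa)(w)=\int_{\mathbb{R}^m}h(w-x)\kappa(x)\,dx$; Lipschitz is with respect to the Euclidean norm on $\mathbb{R}^m$. *)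

theory Defs
  imports
    "HOL-Analysis.Analysis"
    "HOL-Probability.Essential_Supremum"
    "HOL-Library.Multiset"
    "HOL-Library.Disjoint_Sets"
    "HOL-Library.Z2"
begin

section \<open>Simplicial complexes and chains\<close>

definition finite_simplicial_complex :: "'v set \<Rightarrow> 'v set set \<Rightarrow> bool" where
  "finite_simplicial_complex V K \<longleftrightarrow>
     finite V \<and> (\<forall>\<sigma>\<in>K. \<sigma> \<noteq> {} \<and> \<sigma> \<subseteq> V) \<and> (\<forall>x\<in>V. {x} \<in> K) \<and>
     (\<forall>\<sigma>\<in>K. \<forall>\<tau>. \<tau> \<subseteq> \<sigma> \<and> \<tau> \<noteq> {} \<longrightarrow> \<tau> \<in> K)"

text \<open>A chain with \<open>\<int>/2\<close> coefficients is identified with its support, so the space of chains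
  of \<open>K\<close> has underlying set \<open>Pow K\<close>, and the \<open>1\<close>-norm of a chain is its cardinality.\<close>

type_synonym 'v chain = "'v set set"

abbreviation chain_space :: "'v set set \<Rightarrow> 'v chain set" where
  "chain_space K \<equiv> Pow K"


section \<open>Persistence algorithms\<close>

text \<open>Matrices over \<open>\<int>/2\<close> with rows and columns indexed by \<open>K\<close>; only the entries at indices in
  \<open>K\<close> are meaningful. The order of the rows and columns is kept separately, as a reflexive linear
  order on \<open>K\<close>.\<close>

type_synonym 'v simplex_matrix = "'v set \<Rightarrow> 'v set \<Rightarrow> bit"

definition linear_extension :: "'v set set \<Rightarrow> 'v set rel \<Rightarrow> bool" where
  "linear_extension K r \<longleftrightarrow>
     linear_order_on K r \<and> (\<forall>\<sigma>\<in>K. \<forall>\<tau>\<in>K. \<sigma> \<subseteq> \<tau> \<longrightarrow> (\<sigma>, \<tau>) \<in> r)"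

definition boundary_matrix :: "'v set set \<Rightarrow> 'v simplex_matrix" where
  "boundary_matrix K \<sigma> \<tau> =
     of_bool (\<sigma> \<in> K \<and> \<tau> \<in> K \<and> \<sigma> \<subset> \<tau> \<and> card \<tau> = card \<sigma> + 1)"

definition is_pivot ::
  "'v set set \<Rightarrow> 'v set rel \<Rightarrow> 'v simplex_matrix \<Rightarrow> 'v set \<Rightarrow> 'v set \<Rightarrow> bool" where
  "is_pivot K r R \<sigma> \<tau> \<longleftrightarrow>
     \<sigma> \<in> K \<and> R \<sigma> \<tau> \<noteq> 0 \<and> (\<forall>\<rho>\<in>K. R \<rho> \<tau> \<noteq> 0 \<longrightarrow> (\<rho>, \<sigma>) \<in> r)"

definition reduced_matrix :: "'v set set \<Rightarrow> 'v set rel \<Rightarrow> 'v simplex_matrix \<Rightarrow> bool" where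
  "reduced_matrix K r R \<longleftrightarrow>
     (\<forall>\<tau>\<in>K. \<forall>\<tau>'\<in>K. \<forall>\<sigma> \<sigma>'.
        \<tau> \<noteq> \<tau>' \<and> is_pivot K r R \<sigma> \<tau> \<and> is_pivot K r R \<sigma>' \<tau>' \<longrightarrow> \<sigma> \<noteq> \<sigma>')"

definition unit_upper_triangular ::
  "'v set set \<Rightarrow> 'v set rel \<Rightarrow> 'v simplex_matrix \<Rightarrow> bool" where
  "unit_upper_triangular K r V \<longleftrightarrow>
     (\<forall>\<rho>\<in>K. \<forall>\<tau>\<in>K. V \<rho> \<tau> \<noteq> 0 \<longrightarrow> (\<rho>, \<tau>) \<in> r) \<and> (\<forall>\<tau>\<in>K. V \<tau> \<tau> = 1)"

definition is_RDV_decomposition ::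
  "'v set set \<Rightarrow> 'v set rel \<Rightarrow> 'v simplex_matrix \<Rightarrow> 'v simplex_matrix \<Rightarrow> 'v simplex_matrix \<Rightarrow> bool"
where
  "is_RDV_decomposition K r D R V \<longleftrightarrow>
     (\<forall>\<sigma>\<in>K. \<forall>\<tau>\<in>K. R \<sigma> \<tau> = (\<Sum>\<rho>\<in>K. D \<sigma> \<rho> * V \<rho> \<tau>)) \<and>
     reduced_matrix K r R \<and> unit_upper_triangular K r V"

text \<open>The input of an algorithm is a boundary matrix together with the order of its index set,
  the output is the pair \<open>(R, V)\<close>.\<close>

type_synonym 'v algorithm =
  "'v set rel \<Rightarrow> 'v simplex_matrix \<Rightarrow> 'v simplex_matrix \<times> 'v simplex_matrix"

definition persistence_algorithm :: "'v algorithm \<Rightarrow> bool" where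
  "persistence_algorithm \<A> \<longleftrightarrow>
     (\<forall>V K r. finite_simplicial_complex V K \<and> linear_extension K r \<longrightarrow>
        is_RDV_decomposition K r (boundary_matrix K)
          (fst (\<A> r (boundary_matrix K))) (snd (\<A> r (boundary_matrix K))))"

definition birth_death_pairs ::
  "'v set set \<Rightarrow> 'v set rel \<Rightarrow> 'v simplex_matrix \<Rightarrow> ('v set \<times> 'v set) set" where
  "birth_death_pairs K r R = {(\<sigma>, \<tau>). \<tau> \<in> K \<and> is_pivot K r R \<sigma> \<tau>}"

datatype label_kind = Birth_Simplex | Death_Simplex | Representative_Cycle | Bounding_Chain

fun pair_label ::
  "label_kind \<Rightarrow> 'v set set \<Rightarrow> 'v simplex_matrix \<Rightarrow> 'v simplex_matrix \<Rightarrow> 'v set \<times> 'v set \<Rightarrow> 'v chain"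
where
  "pair_label Birth_Simplex K R V (\<sigma>, \<tau>) = {\<sigma>}"
| "pair_label Death_Simplex K R V (\<sigma>, \<tau>) = {\<tau>}"
| "pair_label Representative_Cycle K R V (\<sigma>, \<tau>) = {\<rho>\<in>K. R \<rho> \<tau> \<noteq> 0}"
| "pair_label Bounding_Chain K R V (\<sigma>, \<tau>) = {\<rho>\<in>K. V \<rho> \<tau> \<noteq> 0}"


section \<open>Weights and labeled persistence diagrams\<close>

type_synonym diagram = "(real \<times> real) multiset"
type_synonym 'v labeled_diagram = "(real \<times> real \<times> 'v chain) multiset"

text \<open>Functions are total in HOL: a weight is meaningful only on \<open>K\<close>.\<close>

definition weights :: "'v set set \<Rightarrow> ('v set \<Rightarrow> real) set" where
  "weights K = {w. \<forall>\<sigma>\<in>K. \<forall>\<tau>\<in>K. \<sigma> \<subseteq> \<tau> \<longrightarrow> w \<sigma> \<le> w \<tau>}"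

definition weight_order :: "'v set set \<Rightarrow> 'v set rel \<Rightarrow> ('v set \<Rightarrow> real) \<Rightarrow> 'v set rel" where
  "weight_order K ext w =
     {(\<sigma>, \<tau>). \<sigma> \<in> K \<and> \<tau> \<in> K \<and> (w \<sigma> < w \<tau> \<or> w \<sigma> = w \<tau> \<and> (\<sigma>, \<tau>) \<in> ext)}"

definition weight_diagram ::
  "'v algorithm \<Rightarrow> label_kind \<Rightarrow> 'v set set \<Rightarrow> 'v set rel \<Rightarrow> ('v set \<Rightarrow> real) \<Rightarrow> 'v labeled_diagram"
where
  "weight_diagram \<A> kind K ext w =
     (let r = weight_order K ext w; (R, V) = \<A> r (boundary_matrix K)
      in image_mset (\<lambda>(\<sigma>, \<tau>). (w \<sigma>, w \<tau>, pair_label kind K R V (\<sigma>, \<tau>)))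
           (mset_set (birth_death_pairs K r R)))"

definition param_diagram ::
  "'v algorithm \<Rightarrow> label_kind \<Rightarrow> 'v set set \<Rightarrow> 'v set rel \<Rightarrow>
   'p set \<Rightarrow> ('p \<Rightarrow> 'v set \<Rightarrow> real) \<Rightarrow> 'p \<Rightarrow> 'v labeled_diagram"
where
  "param_diagram \<A> kind K ext A \<psi> x =
     (if x \<in> A then weight_diagram \<A> kind K ext (\<psi> x) else {#})"

text \<open>The labeled diagrams arising from \<open>K\<close>, for a fixed kind of label: any persistence algorithm,
  any linear extension of inclusion and any weight may be used.\<close>

definition labeled_diagrams :: "label_kind \<Rightarrow> 'v set set \<Rightarrow> 'v labeled_diagram set" where
  "labeled_diagrams kind K =
     {P. (\<forall>(b, d, l) \<in># P. b \<le> d \<and> l \<in> chain_space K) \<and>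
         (P = {#} \<or>
          (\<exists>\<A> ext w. persistence_algorithm \<A> \<and> linear_extension K ext \<and> w \<in> weights K \<and>
             P = weight_diagram \<A> kind K ext w))}"

lemma weight_order_linear_extension:
  assumes "linear_extension K ext" "w \<in> weights K"
  shows "linear_extension K (weight_order K ext w)"
proof -
  have lin: "linear_order_on K ext" and ex: "\<And>\<sigma> \<tau>. \<sigma> \<in> K \<Longrightarrow> \<tau> \<in> K \<Longrightarrow> \<sigma> \<subseteq> \<tau> \<Longrightarrow> (\<sigma>, \<tau>) \<in> ext"
    using assms by (auto simp: linear_extension_def)
  have rf: "\<And>\<sigma>. \<sigma> \<in> K \<Longrightarrow> (\<sigma>, \<sigma>) \<in> ext" and tr: "trans ext" and an: "antisym ext" and tot: "total_on K ext"
    using lin by (auto simp: linear_order_on_def partial_order_on_def preorder_on_def refl_on_def)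
  have "trans (weight_order K ext w)"
    unfolding weight_order_def using tr by (auto intro!: transI dest: transD)
  moreover have "antisym (weight_order K ext w)"
    unfolding weight_order_def using an by (auto intro!: antisymI dest: antisymD)
  moreover have "total_on K (weight_order K ext w)"
    unfolding weight_order_def using tot by (auto simp: total_on_def)
  moreover have "refl_on K (weight_order K ext w)" "weight_order K ext w \<subseteq> K \<times> K"
    unfolding weight_order_def using rf by (auto simp: refl_on_def)
  moreover have "(\<sigma>, \<tau>) \<in> weight_order K ext w" if "\<sigma> \<in> K" "\<tau> \<in> K" "\<sigma> \<subseteq> \<tau>" for \<sigma> \<tau>
    using that ex[OF that] assms(2) by (force simp: weight_order_def weights_def)
  ultimately show ?thesis
    by (auto simp: linear_extension_def linear_order_on_def partial_order_on_def preorder_on_def)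
qed

lemma param_diagram_in_labeled_diagrams:
  assumes K: "finite_simplicial_complex V K" and alg: "persistence_algorithm \<A>"
    and ext: "linear_extension K ext" and \<psi>: "\<And>y. y \<in> A \<Longrightarrow> \<psi> y \<in> weights K"
  shows "param_diagram \<A> kind K ext A \<psi> x \<in> labeled_diagrams kind K"
proof (cases "x \<in> A")
  case False
  then show ?thesis by (simp add: param_diagram_def labeled_diagrams_def)
next
  case True
  define w where "w = \<psi> x"
  have w: "w \<in> weights K" using \<psi> True by (simp add: w_def)
  define r where "r = weight_order K ext w"
  define R where "R = fst (\<A> r (boundary_matrix K))"
  define V where "V = snd (\<A> r (boundary_matrix K))"
  have dec: "is_RDV_decomposition K r (boundary_matrix K) R V"
    using alg K weight_order_linear_extension[OF ext w]
    unfolding persistence_algorithm_def R_def V_def r_def by blast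
  have "finite K"
    using K by (auto simp: finite_simplicial_complex_def intro: finite_subset[of K "Pow _"])
  have fin: "finite (birth_death_pairs K r R)"
    by (rule finite_subset[of _ "K \<times> K"])
       (use \<open>finite K\<close> in \<open>auto simp: birth_death_pairs_def is_pivot_def\<close>)
  have pair: "w \<sigma> \<le> w \<tau> \<and> pair_label kind K R V (\<sigma>, \<tau>) \<in> chain_space K"
    if p: "(\<sigma>, \<tau>) \<in> birth_death_pairs K r R" for \<sigma> \<tau>
  proof
    have \<sigma>: "\<sigma> \<in> K" and \<tau>: "\<tau> \<in> K" and nz: "R \<sigma> \<tau> \<noteq> 0"
      using p by (auto simp: birth_death_pairs_def is_pivot_def)
    have "R \<sigma> \<tau> = (\<Sum>\<rho>\<in>K. boundary_matrix K \<sigma> \<rho> * V \<rho> \<tau>)"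
      using dec \<sigma> \<tau> by (simp add: is_RDV_decomposition_def)
    with nz have "(\<Sum>\<rho>\<in>K. boundary_matrix K \<sigma> \<rho> * V \<rho> \<tau>) \<noteq> 0" by simp
    then obtain \<rho> where \<rho>: "\<rho> \<in> K" and nz': "boundary_matrix K \<sigma> \<rho> * V \<rho> \<tau> \<noteq> 0"
      by (rule sum.not_neutral_contains_not_neutral)
    from nz' have D: "boundary_matrix K \<sigma> \<rho> \<noteq> 0" and Vnz: "V \<rho> \<tau> \<noteq> 0"
      by (metis mult_zero_left, metis nz' mult_zero_right)
    have sub: "\<sigma> \<subseteq> \<rho>"
      using D unfolding boundary_matrix_def of_bool_def by (meson psubset_imp_subset)
    have "(\<rho>, \<tau>) \<in> r"
      using dec \<rho> \<tau> Vnz unfolding is_RDV_decomposition_def unit_upper_triangular_def by blast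
    then have "w \<rho> \<le> w \<tau>" by (auto simp: r_def weight_order_def)
    moreover have "w \<sigma> \<le> w \<rho>" using w \<sigma> \<rho> sub by (auto simp: weights_def)
    ultimately show "w \<sigma> \<le> w \<tau>" by simp
    show "pair_label kind K R V (\<sigma>, \<tau>) \<in> chain_space K"
      using \<sigma> \<tau> by (cases kind) auto
  qed
  have "param_diagram \<A> kind K ext A \<psi> x = weight_diagram \<A> kind K ext w"
    using True by (simp add: param_diagram_def w_def)
  moreover have "weight_diagram \<A> kind K ext w =
      image_mset (\<lambda>(\<sigma>, \<tau>). (w \<sigma>, w \<tau>, pair_label kind K R V (\<sigma>, \<tau>)))
        (mset_set (birth_death_pairs K r R))"
    by (simp add: weight_diagram_def Let_def r_def R_def V_def case_prod_unfold)
  moreover have "\<forall>(b, d, l) \<in># weight_diagram \<A> kind K ext w. b \<le> d \<and> l \<in> chain_space K"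
    unfolding calculation(2) using pair fin by (auto simp del: pair_label.simps Pow_iff)
  moreover have "\<exists>\<A>' ext' w'. persistence_algorithm \<A>' \<and> linear_extension K ext' \<and> w' \<in> weights K \<and>
      weight_diagram \<A> kind K ext w = weight_diagram \<A>' kind K ext' w'"
    by (intro exI conjI) (rule alg ext w refl)+
  ultimately show ?thesis
    by (simp only: labeled_diagrams_def mem_Collect_eq simp_thms)
qed

definition forget_labels :: "'v labeled_diagram \<Rightarrow> diagram" where
  "forget_labels P = image_mset (\<lambda>(b, d, l). (b, d)) P"


section \<open>Feature maps and their distributions\<close>

text \<open>A feature map is a function on the multisets of pairs \<open>(b, d)\<close> with \<open>b \<le> d\<close>. Its values
  on other multisets of pairs are junk and never enter below, because forgetting the labels of a
  member of \<open>labeled_diagrams\<close> gives such a multiset.\<close>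

definition labeled_decomposition ::
  "label_kind \<Rightarrow> 'v set set \<Rightarrow> (diagram \<Rightarrow> 'b::real_normed_vector) \<Rightarrow>
   ('v chain \<Rightarrow> 'v labeled_diagram \<Rightarrow> 'b) \<Rightarrow> bool" where
  "labeled_decomposition kind K F Fhat \<longleftrightarrow>
     (\<forall>P \<in> labeled_diagrams kind K. (\<Sum>\<gamma>\<in>chain_space K. Fhat \<gamma> P) = F (forget_labels P))"

definition simplex_distribution ::
  "'v set set \<Rightarrow> ('v chain \<Rightarrow> 'v labeled_diagram \<Rightarrow> 'b::real_normed_vector) \<Rightarrow>
   'v set \<Rightarrow> 'v labeled_diagram \<Rightarrow> 'b" where
  "simplex_distribution K Fhat \<sigma> P =
     (\<Sum>\<gamma> | \<gamma> \<in> chain_space K \<and> \<sigma> \<in> \<gamma>. Fhat \<gamma> P /\<^sub>R real (card \<gamma>))"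

definition geometric_simplex :: "('v \<Rightarrow> real ^ 'd) \<Rightarrow> 'v set \<Rightarrow> (real ^ 'd) set" where
  "geometric_simplex pos \<sigma> = convex hull (pos ` \<sigma>)"

definition geometric_realization :: "('v \<Rightarrow> real ^ 'd) \<Rightarrow> 'v set set \<Rightarrow> (real ^ 'd) set" where
  "geometric_realization pos K = (\<Union>\<sigma>\<in>K. geometric_simplex pos \<sigma>)"

definition simplex_dim :: "('v \<Rightarrow> real ^ 'd) \<Rightarrow> 'v set \<Rightarrow> nat" where
  "simplex_dim pos \<sigma> = nat (aff_dim (geometric_simplex pos \<sigma>))"

text \<open>\<open>k\<close>-dimensional volume of a Borel set \<open>S\<close> lying in some \<open>k\<close>-dimensional affine subspace
  of \<open>\<real>\<^sup>d\<close>: the Lebesgue measure of \<open>S\<close> in orthonormal coordinates on such a subspace. By invariance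
  of Lebesgue measure under isometries the choice of coordinates is irrelevant. For \<open>k = 0\<close> the
  product measure is the unit mass on a single point, which gives the counting measure.
  If no \<open>k\<close>-dimensional affine subspace contains \<open>S\<close>, the value is unspecified.\<close>

definition flat_chart :: "nat \<Rightarrow> real ^ 'd \<Rightarrow> (nat \<Rightarrow> real ^ 'd) \<Rightarrow> (nat \<Rightarrow> real) \<Rightarrow> real ^ 'd" where
  "flat_chart k p e x = p + (\<Sum>i<k. x i *\<^sub>R e i)"

definition is_flat_frame :: "nat \<Rightarrow> (real ^ 'd) set \<Rightarrow> real ^ 'd \<Rightarrow> (nat \<Rightarrow> real ^ 'd) \<Rightarrow> bool" where
  "is_flat_frame k S p e \<longleftrightarrow>
     (\<forall>i<k. \<forall>j<k. e i \<bullet> e j = of_bool (i = j)) \<and> S \<subseteq> range (flat_chart k p e)"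

definition flat_volume :: "nat \<Rightarrow> (real ^ 'd) set \<Rightarrow> real" where
  "flat_volume k S =
     (let (p, e) = (SOME (p, e). is_flat_frame k S p e)
      in measure (\<Pi>\<^sub>M i\<in>{..<k}. lborel) {x \<in> {..<k} \<rightarrow>\<^sub>E UNIV. flat_chart k p e x \<in> S})"

definition half_open_cube :: "real \<Rightarrow> (real ^ 'd) set" where
  "half_open_cube s = {x. \<forall>i. 0 \<le> x $ i \<and> x $ i < s}"

definition cube_partition :: "real \<Rightarrow> (real ^ 'd) set set \<Rightarrow> bool" where
  "cube_partition s \<P> \<longleftrightarrow>
     partition_on UNIV \<P> \<and> (\<forall>c\<in>\<P>. \<exists>t. c = (\<lambda>x. t + x) ` half_open_cube s)"

definition voxels :: "(real ^ 'd) set set \<Rightarrow> ('v \<Rightarrow> real ^ 'd) \<Rightarrow> 'v set set \<Rightarrow> (real ^ 'd) set set" where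
  "voxels \<P> pos K = {c\<in>\<P>. c \<inter> geometric_realization pos K \<noteq> {}}"

definition voxel_distribution ::
  "('v \<Rightarrow> real ^ 'd) \<Rightarrow> 'v set set \<Rightarrow> ('v chain \<Rightarrow> 'v labeled_diagram \<Rightarrow> 'b::real_normed_vector) \<Rightarrow>
   (real ^ 'd) set \<Rightarrow> 'v labeled_diagram \<Rightarrow> 'b" where
  "voxel_distribution pos K Fhat c P =
     (\<Sum>\<sigma>\<in>K.
        (flat_volume (simplex_dim pos \<sigma>) (geometric_simplex pos \<sigma> \<inter> c) /
         flat_volume (simplex_dim pos \<sigma>) (geometric_simplex pos \<sigma>))
        *\<^sub>R simplex_distribution K Fhat \<sigma> P)"


section \<open>Gaussian convolution\<close>

definition convolve :: "(real ^ 'm \<Rightarrow> real) \<Rightarrow> (real ^ 'm \<Rightarrow> real) \<Rightarrow> real ^ 'm \<Rightarrow> real" where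
  "convolve h \<kappa> w = (\<integral>x. h (w - x) * \<kappa> x \<partial>lborel)"

definition gaussian_kernel :: "real \<Rightarrow> real ^ 'm \<Rightarrow> real" where
  "gaussian_kernel a x =
     1 / (a ^ CARD('m) * (2 * pi) powr (real CARD('m) / 2)) * exp (- (1 / (2 * a\<^sup>2)) * (norm x)\<^sup>2)"

end

theory Submission
  imports Defs "HOL-Probability.Distributions"
begin

text \<open>Only the essential bound on \<open>h\<close> matters. Substituting \<open>y = w - x\<close> in the convolution,
  \<open>\<bar>(h * \<kappa>) w - (h * \<kappa>) w'\<bar>\<close> is at most \<open>M\<close> times the \<open>L\<^sup>1\<close> distance between \<open>\<kappa>\<close> and its translate by
  \<open>u = w - w'\<close>. By the fundamental theorem of calculus along the segment from \<open>x\<close> to \<open>x + u\<close> and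
  Tonelli, that distance is at most the \<open>L\<^sup>1\<close> norm of the directional derivative of \<open>\<kappa>\<close>, which is
  \<open>E \<bar>X \<bullet> u\<bar> / a\<^sup>2\<close> for a random vector \<open>X\<close> with density \<open>\<kappa>\<close>. The coordinates of \<open>X\<close> are independent
  and normal, so \<open>X \<bullet> u\<close> is normal with standard deviation \<open>a * norm u\<close>, and
  \<open>E \<bar>X \<bullet> u\<bar> = a * norm u * sqrt (2 / pi)\<close>.\<close>

text \<open>The map is affine with linear part -1, whose determinant has absolute value 1. This
  justifies both substitutions in the convolution integrals.\<close>

lemma distr_lborel_diff:
  fixes w :: "'a::euclidean_space"
  shows "distr lborel borel (\<lambda>x. w - x) = lborel"
proof -
  have "density (distr lborel borel (\<lambda>x. w + (-1) *\<^sub>R x)) (\<lambda>_. ennreal (\<bar>-1\<bar> ^ DIM('a))) = lborel"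
    by (rule lborel_affine[symmetric]) simp
  then show ?thesis by (simp add: density_1)
qed

section \<open>The Gaussian kernel as a product of one-dimensional densities\<close>

text \<open>The squared norm is a sum over coordinates, so the exponential splits, and the constant
  is a power of its one-dimensional counterpart.\<close>

lemma gaussian_kernel_eq_prod:
  fixes x :: "real ^ 'm"
  assumes "0 < a"
  shows "gaussian_kernel a x = (\<Prod>b\<in>Basis. normal_density 0 a (x \<bullet> b))"
proof -
  have norm: "(norm x)\<^sup>2 = (\<Sum>b\<in>Basis. (x \<bullet> b)\<^sup>2)"
    unfolding power2_norm_eq_inner by (subst euclidean_inner) (simp add: power2_eq_square)
  have "(2 * pi) powr (real CARD('m) / 2) = sqrt (2 * pi) ^ CARD('m)"
    by (simp add: powr_half_sqrt[symmetric] powr_realpow[symmetric] powr_powr)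
  then have const: "a ^ CARD('m) * (2 * pi) powr (real CARD('m) / 2) = sqrt (2 * pi * a\<^sup>2) ^ CARD('m)"
    using \<open>0 < a\<close> by (simp add: real_sqrt_mult power_mult_distrib)
  show ?thesis
    unfolding gaussian_kernel_def normal_density_def const norm
    by (simp add: prod.distrib prod_dividef power_one_over exp_sum[symmetric] sum_negf
        sum_divide_distrib[symmetric])
qed

lemma borel_measurable_gaussian_kernel [measurable]: "gaussian_kernel a \<in> borel_measurable borel"
  unfolding gaussian_kernel_def by measurable

text \<open>Density and indicator both factor over the coordinates, so Tonelli applies. Suitable
  choices of the sides give the total mass, the marginals and independence.\<close>

lemma emeasure_gaussian_rectangle:
  fixes A :: "real ^ 'm \<Rightarrow> real set"
  assumes "0 < a" and A: "\<And>b. b \<in> Basis \<Longrightarrow> A b \<in> sets borel"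
  shows "emeasure (density lborel (gaussian_kernel a)) {x. \<forall>b\<in>Basis. x \<bullet> b \<in> A b}
           = (\<Prod>b\<in>Basis. emeasure (density lborel (normal_density 0 a)) (A b))"
proof -
  have "{x. \<forall>b\<in>Basis. x \<bullet> b \<in> A b} = (\<Inter>b\<in>Basis. (\<lambda>x. x \<bullet> b) -` A b \<inter> space borel)"
    by auto
  also have "\<dots> \<in> sets borel"
    using A by (intro sets.finite_INT measurable_sets[where A = borel]) auto
  finally have "emeasure (density lborel (gaussian_kernel a)) {x. \<forall>b\<in>Basis. x \<bullet> b \<in> A b}
      = (\<integral>\<^sup>+x. ennreal (gaussian_kernel a x) * indicator {x. \<forall>b\<in>Basis. x \<bullet> b \<in> A b} x \<partial>lborel)"
    by (simp add: emeasure_density)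
  also have "\<dots> = (\<integral>\<^sup>+x. (\<Prod>b\<in>Basis. ennreal (normal_density 0 a (x \<bullet> b) * indicator (A b) (x \<bullet> b))) \<partial>lborel)"
  proof (rule nn_integral_cong)
    fix x :: "real ^ 'm"
    have "(\<Prod>b\<in>Basis. indicator (A b) (x \<bullet> b)) = (indicator {x. \<forall>b\<in>Basis. x \<bullet> b \<in> A b} x :: ennreal)"
      by (auto simp: indicator_def)
    then show "ennreal (gaussian_kernel a x) * indicator {x. \<forall>b\<in>Basis. x \<bullet> b \<in> A b} x
        = (\<Prod>b\<in>Basis. ennreal (normal_density 0 a (x \<bullet> b) * indicator (A b) (x \<bullet> b)))"
      using \<open>0 < a\<close>
      by (simp add: prod_ennreal gaussian_kernel_eq_prod prod.distrib prod_nonneg ennreal_mult ennreal_indicator)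
  qed
  also have "\<dots> = (\<Prod>b\<in>Basis. \<integral>\<^sup>+t. ennreal (normal_density 0 a t * indicator (A b) t) \<partial>lborel)"
    using A by (intro nn_integral_lborel_prod) auto
  also have "\<dots> = (\<Prod>b\<in>Basis. emeasure (density lborel (normal_density 0 a)) (A b))"
    using A by (intro prod.cong) (auto simp: emeasure_density ennreal_mult ennreal_indicator)
  finally show ?thesis .
qed

text \<open>The rectangle with all sides \<open>UNIV\<close> is the whole space, and each of its
  factors is 1.\<close>

lemma prob_space_gaussian:
  assumes "0 < a"
  shows "prob_space (density lborel (gaussian_kernel a :: real ^ 'm \<Rightarrow> real))"
proof (rule prob_spaceI)
  interpret N: prob_space "density lborel (normal_density 0 a)"
    using assms by (rule prob_space_normal_density)
  show "emeasure (density lborel (gaussian_kernel a :: real ^ 'm \<Rightarrow> real))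
      (space (density lborel (gaussian_kernel a))) = 1"
    using emeasure_gaussian_rectangle[OF assms, of "\<lambda>_. UNIV"] N.emeasure_space_1 by simp
qed

lemma gaussian_kernel_nonneg: "0 < a \<Longrightarrow> 0 \<le> gaussian_kernel a x"
  by (simp add: gaussian_kernel_def)

lemma integrable_gaussian_kernel:
  assumes "0 < a"
  shows "integrable lborel (gaussian_kernel a :: real ^ 'm \<Rightarrow> real)"
proof (rule integrableI_nonneg)
  interpret prob_space "density lborel (gaussian_kernel a :: real ^ 'm \<Rightarrow> real)"
    using assms by (rule prob_space_gaussian)
  show "(\<integral>\<^sup>+x. ennreal (gaussian_kernel a (x :: real ^ 'm)) \<partial>lborel) < \<infinity>"
    using emeasure_space_1 by (simp add: emeasure_density)
qed (use assms in \<open>simp_all add: gaussian_kernel_nonneg\<close>)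

section \<open>Marginals, independence and the first absolute moment\<close>

text \<open>The preimage is a rectangle with side \<open>A\<close> in direction \<open>b\<close> and
  \<open>UNIV\<close> elsewhere; the other factors are 1.\<close>

lemma emeasure_gaussian_component:
  fixes b :: "real ^ 'm"
  assumes "0 < a" "b \<in> Basis" "A \<in> sets borel"
  shows "emeasure (density lborel (gaussian_kernel a)) ((\<lambda>x. x \<bullet> b) -` A)
           = emeasure (density lborel (normal_density 0 a)) A"
proof -
  interpret N: prob_space "density lborel (normal_density 0 a)"
    using \<open>0 < a\<close> by (rule prob_space_normal_density)
  have "(\<lambda>x. x \<bullet> b) -` A = {x. \<forall>b'\<in>Basis. x \<bullet> b' \<in> (if b' = b then A else UNIV)}"
    using assms(2) by auto
  then show ?thesis
    using emeasure_gaussian_rectangle[OF assms(1), of "\<lambda>b'. if b' = b then A else UNIV"]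
      assms(2,3) N.emeasure_space_1
    by (simp add: prod.remove[of Basis b])
qed

lemma distributed_gaussian_component:
  fixes b :: "real ^ 'm"
  assumes "0 < a" "b \<in> Basis"
  shows "distributed (density lborel (gaussian_kernel a)) lborel (\<lambda>x. x \<bullet> b) (normal_density 0 a)"
  unfolding distributed_def
proof (intro conjI)
  show "distr (density lborel (gaussian_kernel a)) lborel (\<lambda>x. x \<bullet> b) = density lborel (normal_density 0 a)"
    by (rule measure_eqI) (use assms in \<open>simp_all add: emeasure_distr emeasure_gaussian_component\<close>)
qed simp_all

text \<open>For finitely many variables it suffices to check the product formula on an
  intersection-stable generator containing the whole space; here that is all Borel sets, and the
  formula is the one for rectangles.\<close>

lemma indep_vars_gaussian_components:
  assumes "0 < a"
  shows "prob_space.indep_vars (density lborel (gaussian_kernel a)) (\<lambda>_. borel)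
           (\<lambda>b x. x \<bullet> b) (Basis :: (real ^ 'm) set)"
proof -
  interpret prob_space "density lborel (gaussian_kernel a :: real ^ 'm \<Rightarrow> real)"
    using assms by (rule prob_space_gaussian)
  have "prob (\<Inter>b\<in>Basis. (\<lambda>x. x \<bullet> b) -` A b \<inter> space (density lborel (gaussian_kernel a)))
      = (\<Prod>b\<in>Basis. prob ((\<lambda>x. x \<bullet> b) -` A b \<inter> space (density lborel (gaussian_kernel a))))"
    if A: "A \<in> Basis \<rightarrow> sets borel" for A :: "real ^ 'm \<Rightarrow> real set"
  proof -
    have "ennreal (prob (\<Inter>b\<in>Basis. (\<lambda>x. x \<bullet> b) -` A b))
        = emeasure (density lborel (gaussian_kernel a)) {x :: real ^ 'm. \<forall>b\<in>Basis. x \<bullet> b \<in> A b}"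
      unfolding emeasure_eq_measure[symmetric] by (rule arg_cong2[where f = emeasure]) auto
    also have "\<dots> = (\<Prod>b\<in>Basis. ennreal (prob ((\<lambda>x. x \<bullet> b) -` A b)))"
      using assms A
      by (subst emeasure_gaussian_rectangle)
        (auto simp: Pi_iff emeasure_eq_measure[symmetric] emeasure_gaussian_component intro!: prod.cong)
    also have "\<dots> = ennreal (\<Prod>b\<in>Basis. prob ((\<lambda>x. x \<bullet> b) -` A b))"
      by (simp add: prod_ennreal)
    finally show ?thesis
      by (simp add: prod_nonneg)
  qed
  then show ?thesis
    by (subst indep_vars_finite[where E = "\<lambda>_. sets borel"])
      (auto simp: Int_stable_def sets.sigma_sets_eq[of borel, simplified])
qed

lemma nn_integral_gaussian_abs_inner:
  fixes u :: "real ^ 'm"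
  assumes "0 < a"
  shows "(\<integral>\<^sup>+x. ennreal (gaussian_kernel a x * \<bar>x \<bullet> u\<bar>) \<partial>lborel) = ennreal (a * sqrt (2 / pi) * norm u)"
proof (cases "u = 0")
  case False
  let ?N = "density lborel (gaussian_kernel a :: real ^ 'm \<Rightarrow> real)"
  \<comment> \<open>\<open>sum_indep_normal\<close> needs a nonempty index set and positive standard
    deviations, so the coordinates where \<open>u\<close> vanishes are dropped; they contribute
    nothing to \<open>x \<bullet> u\<close>.\<close>
  let ?I = "{b\<in>Basis. u \<bullet> b \<noteq> 0}"
  interpret prob_space ?N
    using assms by (rule prob_space_gaussian)
  have "?I \<noteq> {}"
    using False by (auto simp: euclidean_eq_iff[of u])
  have "distributed ?N lborel (\<lambda>x. \<Sum>b\<in>?I. (u \<bullet> b) * (x \<bullet> b))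
      (normal_density (\<Sum>b\<in>?I. 0) (sqrt (\<Sum>b\<in>?I. (\<bar>u \<bullet> b\<bar> * a)\<^sup>2)))"
  proof (rule sum_indep_normal)
    have "indep_vars (\<lambda>_. borel) (\<lambda>b x. x \<bullet> b) ?I"
      using indep_vars_gaussian_components[OF assms] by (rule indep_vars_subset) auto
    then show "indep_vars (\<lambda>_. borel) (\<lambda>b x. (u \<bullet> b) * (x \<bullet> b)) ?I"
      by (rule indep_vars_compose2) simp
    show "distributed ?N lborel (\<lambda>x. (u \<bullet> b) * (x \<bullet> b)) (normal_density 0 (\<bar>u \<bullet> b\<bar> * a))"
      if "b \<in> ?I" for b
      using normal_density_affine[where \<beta> = 0 and \<alpha> = "u \<bullet> b", OF distributed_gaussian_component[of a b]]
        that assms by simp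
  qed (use \<open>?I \<noteq> {}\<close> assms in auto)
  moreover have "(\<Sum>b\<in>?I. (u \<bullet> b) * (x \<bullet> b)) = x \<bullet> u" for x
    by (subst euclidean_inner[of x u], rule sum.mono_neutral_cong_left) (auto simp: mult.commute)
  moreover have "sqrt (\<Sum>b\<in>?I. (\<bar>u \<bullet> b\<bar> * a)\<^sup>2) = a * norm u"
  proof -
    have "(\<Sum>b\<in>?I. (\<bar>u \<bullet> b\<bar> * a)\<^sup>2) = (\<Sum>b\<in>Basis. (u \<bullet> b) * (u \<bullet> b) * a\<^sup>2)"
      by (rule sum.mono_neutral_cong_left) (auto simp: power_mult_distrib power2_eq_square)
    also have "\<dots> = (norm u)\<^sup>2 * a\<^sup>2"
      unfolding power2_norm_eq_inner by (subst euclidean_inner) (simp add: sum_distrib_right)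
    finally show ?thesis
      using assms by (simp add: real_sqrt_mult)
  qed
  ultimately have "distributed ?N lborel (\<lambda>x. x \<bullet> u) (normal_density 0 (a * norm u))"
    by simp
  from distributed_nn_integral[OF this, of "\<lambda>t. ennreal \<bar>t\<bar>"]
  have "(\<integral>\<^sup>+x. ennreal (gaussian_kernel a x * \<bar>x \<bullet> u\<bar>) \<partial>lborel)
      = (\<integral>\<^sup>+t. ennreal (normal_density 0 (a * norm u) t * \<bar>t\<bar>) \<partial>lborel)"
    using assms by (simp add: nn_integral_density ennreal_mult gaussian_kernel_nonneg)
  also have "\<dots> = ennreal (a * sqrt (2 / pi) * norm u)"
    \<comment> \<open>The odd absolute moment of order 2 * 0 + 1 is the mean of the absolute value;
      it requires a positive standard deviation, hence \<open>u \<noteq> 0\<close>.\<close>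
    using normal_moment_abs_odd[of "a * norm u" 0 0] False assms
    by (simp add: has_bochner_integral_iff nn_integral_eq_integral mult_ac)
  finally show ?thesis .
qed simp

section \<open>Translates of the kernel in \<open>L\<^sup>1\<close>\<close>

lemma has_real_derivative_gaussian_kernel_line:
  assumes "a \<noteq> 0"
  shows "((\<lambda>s. gaussian_kernel a (x + s *\<^sub>R u)) has_real_derivative
           - (gaussian_kernel a (x + s *\<^sub>R u) * ((x + s *\<^sub>R u) \<bullet> u) / a\<^sup>2)) (at s)"
proof -
  \<comment> \<open>As a polynomial in \<open>s\<close>, the exponent is within reach of the real
    differentiation rules.\<close>
  have norm: "(norm (x + s *\<^sub>R u))\<^sup>2 = x \<bullet> x + 2 * s * (x \<bullet> u) + s\<^sup>2 * (u \<bullet> u)" for s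
    unfolding power2_norm_eq_inner
    by (simp add: inner_add_left inner_add_right inner_commute power2_eq_square algebra_simps)
  show ?thesis
    unfolding gaussian_kernel_def norm
    by (rule derivative_eq_intros refl)+
      (use assms in \<open>simp add: field_simps inner_simps power2_eq_square\<close>)
qed

lemma nn_integral_gaussian_kernel_translate_le:
  fixes u :: "real ^ 'm"
  assumes "0 < a"
  shows "(\<integral>\<^sup>+x. ennreal \<bar>gaussian_kernel a (x + u) - gaussian_kernel a x\<bar> \<partial>lborel)
           \<le> ennreal (2 / (a * sqrt (2 * pi)) * norm u)"
proof -
  \<comment> \<open>\<open>D\<close> is the directional derivative of the kernel along
    \<open>u\<close>.\<close>
  define D where "D y = - (gaussian_kernel a y * (y \<bullet> u) / a\<^sup>2)" for y :: "real ^ 'm"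
  have [measurable]: "D \<in> borel_measurable borel"
    unfolding D_def by measurable
  have cont: "continuous_on S (\<lambda>s. D (x + s *\<^sub>R u))" for S x
    unfolding D_def gaussian_kernel_def by (intro continuous_intros) (use assms in auto)
  have pointwise: "ennreal \<bar>gaussian_kernel a (x + u) - gaussian_kernel a x\<bar>
      \<le> (\<integral>\<^sup>+s. ennreal \<bar>D (x + s *\<^sub>R u)\<bar> * indicator {0..1} s \<partial>lborel)" for x
  proof -
    have "has_bochner_integral lborel (\<lambda>s. indicator {0..1} s *\<^sub>R D (x + s *\<^sub>R u))
        (gaussian_kernel a (x + 1 *\<^sub>R u) - gaussian_kernel a (x + 0 *\<^sub>R u))"
      using zero_le_one
    proof (rule has_bochner_integral_FTC_Icc)
      show "((\<lambda>s. gaussian_kernel a (x + s *\<^sub>R u)) has_vector_derivative D (x + s *\<^sub>R u))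
          (at s within {0..1})" for s
        unfolding has_real_derivative_iff_has_vector_derivative[symmetric] D_def
        using assms
        by (simp add: has_field_derivative_at_within[OF has_real_derivative_gaussian_kernel_line])
    qed (rule cont)
    then have "ennreal (norm (gaussian_kernel a (x + u) - gaussian_kernel a x))
        \<le> (\<integral>\<^sup>+s. norm (indicator {0..1} s *\<^sub>R D (x + s *\<^sub>R u)) \<partial>lborel)"
      using integral_norm_bound_ennreal[of lborel "\<lambda>s. indicator {0..1} s *\<^sub>R D (x + s *\<^sub>R u)"]
      unfolding has_bochner_integral_iff by simp
    also have "\<dots> = (\<integral>\<^sup>+s. ennreal \<bar>D (x + s *\<^sub>R u)\<bar> * indicator {0..1} s \<partial>lborel)"
      by (intro nn_integral_cong) (auto split: split_indicator)
    finally show ?thesis by simp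
  qed
  have "(\<integral>\<^sup>+x. ennreal \<bar>gaussian_kernel a (x + u) - gaussian_kernel a x\<bar> \<partial>lborel)
      \<le> (\<integral>\<^sup>+x. (\<integral>\<^sup>+s. ennreal \<bar>D (x + s *\<^sub>R u)\<bar> * indicator {0..1} s \<partial>lborel) \<partial>lborel)"
    by (intro nn_integral_mono pointwise)
  also have "\<dots> = (\<integral>\<^sup>+s. (\<integral>\<^sup>+x. ennreal \<bar>D (x + s *\<^sub>R u)\<bar> * indicator {0..1} s \<partial>lborel) \<partial>lborel)"
    by (rule lborel_pair.Fubini') measurable
  \<comment> \<open>By translation invariance the inner integral is the same for every
    \<open>s\<close> in the unit interval, whose length 1 then leaves no extra factor.\<close>
  also have "\<dots> = (\<integral>\<^sup>+s. (\<integral>\<^sup>+x. ennreal \<bar>D x\<bar> \<partial>lborel) * indicator {0..1::real} s \<partial>lborel)"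
  proof (intro nn_integral_cong)
    fix s :: real
    have "(\<integral>\<^sup>+x. ennreal \<bar>D x\<bar> \<partial>lborel) = (\<integral>\<^sup>+x. ennreal \<bar>D x\<bar> \<partial>distr lborel borel ((+) (s *\<^sub>R u)))"
      by (simp add: lborel_distr_plus)
    also have "\<dots> = (\<integral>\<^sup>+x. ennreal \<bar>D (x + s *\<^sub>R u)\<bar> \<partial>lborel)"
      by (simp add: nn_integral_distr add.commute)
    finally show "(\<integral>\<^sup>+x. ennreal \<bar>D (x + s *\<^sub>R u)\<bar> * indicator {0..1} s \<partial>lborel)
        = (\<integral>\<^sup>+x. ennreal \<bar>D x\<bar> \<partial>lborel) * indicator {0..1} s"
      by (simp add: nn_integral_multc)
  qed
  also have "\<dots> = (\<integral>\<^sup>+x. ennreal \<bar>D x\<bar> \<partial>lborel)"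
    by (simp add: nn_integral_cmult_indicator)
  also have "\<dots> = (\<integral>\<^sup>+x. ennreal (1 / a\<^sup>2) * ennreal (gaussian_kernel a x * \<bar>x \<bullet> u\<bar>) \<partial>lborel)"
    using assms
    by (intro nn_integral_cong) (simp add: D_def abs_mult gaussian_kernel_nonneg ennreal_mult[symmetric])
  also have "\<dots> = ennreal (1 / a\<^sup>2 * (a * sqrt (2 / pi) * norm u))"
    using assms by (simp add: nn_integral_cmult nn_integral_gaussian_abs_inner ennreal_mult[symmetric])
  also have "1 / a\<^sup>2 * (a * sqrt (2 / pi) * norm u) = 2 / (a * sqrt (2 * pi)) * norm u"
    using assms by (simp add: power2_eq_square real_sqrt_divide real_sqrt_mult field_simps)
  finally show ?thesis .
qed

section \<open>From translates of the kernel to the Lipschitz bound\<close>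

lemma lipschitz_on_convolve:
  fixes h \<kappa> :: "real ^ 'm \<Rightarrow> real"
  assumes h [measurable]: "h \<in> borel_measurable borel" and bound: "AE x in lborel. \<bar>h x\<bar> \<le> M"
    and "0 \<le> M" "0 \<le> L" and \<kappa>: "integrable lborel \<kappa>"
    and translate: "\<And>u. (\<integral>\<^sup>+x. ennreal \<bar>\<kappa> (x + u) - \<kappa> x\<bar> \<partial>lborel) \<le> ennreal (L * norm u)"
  shows "(M * L)-lipschitz_on UNIV (convolve h \<kappa>)"
proof (rule lipschitz_onI)
  have [measurable]: "\<kappa> \<in> borel_measurable borel"
    using \<kappa> by simp
  \<comment> \<open>Moving \<open>w\<close> into the kernel lets the integrals for two points share
    the factor \<open>h y\<close>, which is then bounded by \<open>M\<close> almost
    everywhere.\<close>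
  have subst: "convolve h \<kappa> w = (\<integral>y. h y * \<kappa> (w - y) \<partial>lborel)" for w
  proof -
    have "(\<integral>y. h y * \<kappa> (w - y) \<partial>lborel) = (\<integral>y. h y * \<kappa> (w - y) \<partial>distr lborel borel (\<lambda>x. w - x))"
      by (simp add: distr_lborel_diff)
    also have "\<dots> = convolve h \<kappa> w"
      by (simp add: integral_distr convolve_def)
    finally show ?thesis by simp
  qed
  have int: "integrable lborel (\<lambda>y. h y * \<kappa> (w - y))" for w
  proof (rule Bochner_Integration.integrable_bound)
    have "integrable (distr lborel borel (\<lambda>x. w - x)) \<kappa>"
      using \<kappa> by (simp add: distr_lborel_diff)
    then show "integrable lborel (\<lambda>y. M * \<kappa> (w - y))"
      by (simp add: integrable_distr_eq)
    show "AE y in lborel. norm (h y * \<kappa> (w - y)) \<le> norm (M * \<kappa> (w - y))"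
      using bound \<open>0 \<le> M\<close> by (auto simp: abs_mult intro: mult_right_mono elim!: eventually_mono)
  qed measurable
  fix w w' :: "real ^ 'm"
  have "ennreal (dist (convolve h \<kappa> w) (convolve h \<kappa> w'))
      = ennreal (norm (\<integral>y. h y * \<kappa> (w - y) - h y * \<kappa> (w' - y) \<partial>lborel))"
    by (simp add: dist_norm subst int)
  also have "\<dots> \<le> (\<integral>\<^sup>+y. ennreal (norm (h y * \<kappa> (w - y) - h y * \<kappa> (w' - y))) \<partial>lborel)"
    by (intro integral_norm_bound_ennreal Bochner_Integration.integrable_diff int)
  also have "\<dots> \<le> (\<integral>\<^sup>+y. ennreal M * ennreal \<bar>\<kappa> (w - y) - \<kappa> (w' - y)\<bar> \<partial>lborel)"
    using bound \<open>0 \<le> M\<close>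
    by (intro nn_integral_mono_AE)
      (auto simp: abs_mult ennreal_mult[symmetric] right_diff_distrib[symmetric]
        intro!: ennreal_leI mult_right_mono elim!: eventually_mono)
  also have "\<dots> = ennreal M * (\<integral>\<^sup>+y. ennreal \<bar>\<kappa> (w - y) - \<kappa> (w' - y)\<bar> \<partial>lborel)"
    by (simp add: nn_integral_cmult)
  \<comment> \<open>With y = w' - x the two arguments become x + (w - w') and x, the form bounded by
    \<open>translate\<close>.\<close>
  also have "(\<integral>\<^sup>+y. ennreal \<bar>\<kappa> (w - y) - \<kappa> (w' - y)\<bar> \<partial>lborel)
      = (\<integral>\<^sup>+y. ennreal \<bar>\<kappa> (w - y) - \<kappa> (w' - y)\<bar> \<partial>distr lborel borel (\<lambda>x. w' - x))"
    by (simp add: distr_lborel_diff)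
  also have "\<dots> = (\<integral>\<^sup>+x. ennreal \<bar>\<kappa> (x + (w - w')) - \<kappa> x\<bar> \<partial>lborel)"
    by (simp add: nn_integral_distr algebra_simps)
  also have "ennreal M * \<dots> \<le> ennreal M * ennreal (L * norm (w - w'))"
    by (intro mult_left_mono translate) simp
  also have "\<dots> = ennreal (M * L * dist w w')"
    using \<open>0 \<le> M\<close> \<open>0 \<le> L\<close> by (simp add: ennreal_mult[symmetric] dist_norm mult.assoc)
  finally show "dist (convolve h \<kappa> w) (convolve h \<kappa> w') \<le> M * L * dist w w'"
    using \<open>0 \<le> M\<close> \<open>0 \<le> L\<close> by (simp add: ennreal_le_iff)
qed (use assms in simp)

theorem theorem6p4:
  fixes V :: "'v set"
    and K :: "'v set set"
    and pos :: "'v \<Rightarrow> real ^ 'd"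
    and s :: real
    and \<P> :: "(real ^ 'd) set set"
    and \<A> :: "'v algorithm"
    and kind :: label_kind
    and ext :: "'v set rel"
    and A :: "(real ^ 'm) set"
    and \<psi> :: "real ^ 'm \<Rightarrow> 'v set \<Rightarrow> real"
    and F :: "diagram \<Rightarrow> 'b::{banach, second_countable_topology}"
    and Fhat :: "'v chain \<Rightarrow> 'v labeled_diagram \<Rightarrow> 'b"
    and g :: "'b \<Rightarrow> real"
    and h :: "real ^ 'm \<Rightarrow> real"
    and a M :: real
  assumes "finite_simplicial_complex V K"
    and "s > 0" and "cube_partition s \<P>"
    and "persistence_algorithm \<A>"
    and "linear_extension K ext"
    and "\<And>x. x \<in> A \<Longrightarrow> \<psi> x \<in> weights K"
    and "labeled_decomposition kind K F Fhat"
    and "(\<exists>\<gamma>\<in>chain_space K. h = g \<circ> Fhat \<gamma> \<circ> param_diagram \<A> kind K ext A \<psi>) \<or>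
         (\<exists>\<sigma>\<in>K. h = g \<circ> simplex_distribution K Fhat \<sigma> \<circ> param_diagram \<A> kind K ext A \<psi>) \<or>
         (\<exists>c\<in>voxels \<P> pos K.
            h = g \<circ> voxel_distribution pos K Fhat c \<circ> param_diagram \<A> kind K ext A \<psi>)"
    and "h \<in> borel_measurable borel"
    and "a > 0"
    and "esssup lborel (\<lambda>x. ereal \<bar>h x\<bar>) \<le> ereal M"
  shows "(2 * M / (a * sqrt (2 * pi)))-lipschitz_on UNIV (convolve h (gaussian_kernel a))"
proof -
  have bound: "AE x in lborel. \<bar>h x\<bar> \<le> M"
    using esssup_AE[of "\<lambda>x. ereal \<bar>h x\<bar>" lborel] assms(11)
    by (auto elim!: eventually_mono dest: order_trans)
  \<comment> \<open>The bound forces \<open>M\<close> to be nonnegative wherever it holds. Lebesgue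
    measure is not the null measure, so a constant statement true almost everywhere is true.\<close>
  have "AE x in (lborel :: (real ^ 'm) measure). 0 \<le> M"
    using bound by (rule eventually_mono) linarith
  then have "0 \<le> M"
    by (simp add: eventually_const ae_filter_eq_bot_iff)
  have "(M * (2 / (a * sqrt (2 * pi))))-lipschitz_on UNIV (convolve h (gaussian_kernel a))"
    using \<open>0 < a\<close>
    by (intro lipschitz_on_convolve assms(9) bound \<open>0 \<le> M\<close> integrable_gaussian_kernel
        nn_integral_gaussian_kernel_translate_le) simp
  then show ?thesis by (simp add: mult.commute)
qed

end
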